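(* Let $n\in\mathbb{N}$ with $n\ge 2$ and let $f\in\mathcal{F}$. Then the point $\frac{1}{n}$ is not an isolated point of $H(f)$.
   Context: $\mathbb{N}$ denotes the set of positive integers. $\mathcal{F}$ denotes the class of all continuous functions $f:[0,1]\to\mathbb{R}$ with $f(0)=f(1)=0$. For $f\in\mathcal{F}$, the set of chords of $f$ is $$H(f):=\{\ell\in[0,1] : f(x-\ell)=f(x)\ \text{for some}\ x\in[\ell,1]\}.$$ A point $p$ of a set $S\subset\mathbb{R}$ is isolated in $S$ if $p\in S$ and there is $\varepsilon>0$ with $S\cap(p-\varepsilon,p+\varepsilon)=\{p\}$. *)

theory Defs
  imports "HOL-Analysis.Analysis"
begin

text \<open>A function on the unit interval is represented by a total function on the reals; the
  values outside the interval play no role below.\<close>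

definition chord_class :: "(real \<Rightarrow> real) set"
  where "chord_class = {f. continuous_on {0..1} f \<and> f 0 = 0 \<and> f 1 = 0}"

definition chord_set :: "(real \<Rightarrow> real) \<Rightarrow> real set"
  where "chord_set f = {l \<in> {0..1}. \<exists>x\<in>{l..1}. f (x - l) = f x}"

text \<open>On the real line, the library's topological notion of isolated point is the usual one in
  terms of symmetric open intervals.\<close>

lemma isolated_in_real_iff:
  fixes p :: real
  shows "p isolated_in S \<longleftrightarrow> p \<in> S \<and> (\<exists>\<epsilon>>0. S \<inter> {p - \<epsilon><..<p + \<epsilon>} = {p})"
proof
  assume "p isolated_in S"
  then obtain e where "p \<in> S" "e > 0" "\<And>y. y \<in> S \<Longrightarrow> dist p y < e \<Longrightarrow> y = p"
    unfolding isolated_in_dist_Ex_iff by blast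
  then have "S \<inter> {p - e<..<p + e} = {p}"
    by (auto simp: dist_real_def abs_less_iff)
  with \<open>p \<in> S\<close> \<open>e > 0\<close> show "p \<in> S \<and> (\<exists>\<epsilon>>0. S \<inter> {p - \<epsilon><..<p + \<epsilon>} = {p})"
    by blast
next
  assume "p \<in> S \<and> (\<exists>\<epsilon>>0. S \<inter> {p - \<epsilon><..<p + \<epsilon>} = {p})"
  then obtain e where "p \<in> S" "S \<inter> {p - e<..<p + e} = {p}"
    by blast
  then show "p isolated_in S"
    by (intro isolated_inI[of p S "{p - e<..<p + e}"]) auto
qed

end

theory Submission
  imports Defs
begin

text \<open>
  The proof rests on Hopf's observation that the lengths in \<open>[0,1]\<close> that are not chords are closed
  under addition as long as the sum stays in \<open>[0,1]\<close> (\<open>chord_set_complement_add\<close>). If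
  \<open>1/n\<close> were isolated among the chords, then for small \<open>\<delta> > 0\<close> neither \<open>1/n + \<delta>\<close> nor
  \<open>1/n - (n - 1) \<delta>\<close> would be a chord. Adding \<open>n - 1\<close> copies of the former to the latter gives
  exactly \<open>1\<close>, so \<open>1\<close> would not be a chord; but it is one, since \<open>f 0 = f 1\<close>.

  For the additivity, a length \<open>a\<close> that is not a chord gives the increment \<open>f (x + a) - f x\<close> a
  constant sign. Two such lengths \<open>a\<close> and \<open>b\<close> with \<open>a + b \<le> 1\<close> have the same sign, because with
  opposite signs, say positive for \<open>a\<close>, no point of \<open>[0,a + b]\<close> could be a maximum of \<open>f\<close>: either a step of \<open>a\<close> to the
  right or a step of \<open>b\<close> to the left stays in the interval and increases \<open>f\<close>. With equal signs the
  increments over \<open>a\<close> and \<open>b\<close> add up without cancelling.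
\<close>

lemma chord_set_iff:
  "l \<in> chord_set f \<longleftrightarrow> 0 \<le> l \<and> l \<le> 1 \<and> (\<exists>x\<in>{0..1 - l}. f (x + l) = f x)"
proof -
  have "(\<exists>x\<in>{l..1}. f (x - l) = f x) \<longleftrightarrow> (\<exists>x\<in>{0..1 - l}. f (x + l) = f x)"
  proof
    assume "\<exists>x\<in>{l..1}. f (x - l) = f x"
    then obtain x where "x \<in> {l..1}" "f (x - l) = f x" by blast
    then show "\<exists>x\<in>{0..1 - l}. f (x + l) = f x"
      by (intro bexI[of _ "x - l"]) auto
  next
    assume "\<exists>x\<in>{0..1 - l}. f (x + l) = f x"
    then obtain x where "x \<in> {0..1 - l}" "f (x + l) = f x" by blast
    then show "\<exists>x\<in>{l..1}. f (x - l) = f x"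
      by (intro bexI[of _ "x + l"]) auto
  qed
  then show ?thesis by (auto simp: chord_set_def)
qed

lemma chord_set_uminus: "chord_set (\<lambda>x. - f x) = chord_set f"
  by (simp add: chord_set_def)

text \<open>The increment over a fixed length is continuous, so it cannot change sign without
  vanishing, and where it vanishes there is a chord of that length.\<close>

lemma increment_constant_sign:
  fixes f :: "real \<Rightarrow> real"
  assumes cont: "continuous_on {0..1} f"
    and a: "0 \<le> a" "a \<le> 1" "a \<notin> chord_set f"
  shows "(\<forall>x\<in>{0..1 - a}. f x < f (x + a)) \<or> (\<forall>x\<in>{0..1 - a}. f (x + a) < f x)"
proof (rule ccontr)
  let ?d = "\<lambda>x. f (x + a) - f x"
  assume "\<not> ?thesis"
  then obtain x y where xy: "x \<in> {0..1 - a}" "y \<in> {0..1 - a}" "?d x \<le> 0" "0 \<le> ?d y"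
    by (auto simp: not_less)
  have "continuous_on {0..1 - a} ?d"
    using a by (intro continuous_intros continuous_on_compose2[OF cont]
        continuous_on_subset[OF cont]) auto
  then have "connected (?d ` {0..1 - a})"
    by (intro connected_continuous_image) auto
  then have "0 \<in> ?d ` {0..1 - a}"
    using xy by (meson connectedD_interval imageI)
  then show False
    using a by (auto simp: chord_set_iff)
qed

text \<open>Opposite signs fail at a maximum point of \<open>f\<close> on \<open>[0,a + b]\<close>: it admits a step
  to the right by \<open>a\<close> or a step to the left by \<open>b\<close>, and either one would increase \<open>f\<close>.\<close>

lemma no_opposite_increments:
  fixes f :: "real \<Rightarrow> real"
  assumes cont: "continuous_on {0..a + b} f" and "0 \<le> a" "0 \<le> b"
    and up: "\<And>x. x \<in> {0..b} \<Longrightarrow> f x < f (x + a)"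
    and down: "\<And>x. x \<in> {0..a} \<Longrightarrow> f (x + b) < f x"
  shows False
proof -
  obtain x where x: "x \<in> {0..a + b}" and max: "\<And>y. y \<in> {0..a + b} \<Longrightarrow> f y \<le> f x"
    using continuous_attains_sup[OF compact_Icc _ cont] \<open>0 \<le> a\<close> \<open>0 \<le> b\<close> by auto
  show False
  proof (cases "x \<le> b")
    case True
    then show False using up[of x] max[of "x + a"] x \<open>0 \<le> a\<close> by auto
  next
    case False
    then show False using down[of "x - b"] max[of "x - b"] x \<open>0 \<le> b\<close> by auto
  qed
qed

lemma sum_not_chord_if_increasing:
  fixes f :: "real \<Rightarrow> real"
  assumes cont: "continuous_on {0..1} f"
    and ab: "0 \<le> a" "0 \<le> b" "a + b \<le> 1" and b: "b \<notin> chord_set f"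
    and up: "\<forall>x\<in>{0..1 - a}. f x < f (x + a)"
  shows "a + b \<notin> chord_set f"
proof -
  have "\<not> (\<forall>x\<in>{0..1 - b}. f (x + b) < f x)"
  proof
    assume "\<forall>x\<in>{0..1 - b}. f (x + b) < f x"
    then show False
      using ab up by (intro no_opposite_increments[of a b f]
          continuous_on_subset[OF cont]) auto
  qed
  then have up': "\<forall>x\<in>{0..1 - b}. f x < f (x + b)"
    using increment_constant_sign[OF cont _ _ b] ab by auto
  have "f x < f (x + (a + b))" if "x \<in> {0..1 - (a + b)}" for x
  proof -
    have "f x < f (x + a)" using that ab up by auto
    also have "\<dots> < f (x + a + b)" using that ab up' by auto
    finally show ?thesis by (simp add: add.assoc)
  qed
  then show ?thesis by (force simp: chord_set_iff)
qed

text \<open>Passing from \<open>f\<close> to \<open>- f\<close> keeps the chords and reverses the sign of the increments, so the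
  sign of the increment over \<open>a\<close> may be taken positive.\<close>

lemma chord_set_complement_add:
  fixes f :: "real \<Rightarrow> real"
  assumes cont: "continuous_on {0..1} f"
    and ab: "0 \<le> a" "0 \<le> b" "a + b \<le> 1" and "a \<notin> chord_set f" "b \<notin> chord_set f"
  shows "a + b \<notin> chord_set f"
proof -
  consider "\<forall>x\<in>{0..1 - a}. f x < f (x + a)" | "\<forall>x\<in>{0..1 - a}. f (x + a) < f x"
    using increment_constant_sign[OF cont _ _ \<open>a \<notin> chord_set f\<close>] ab by auto
  then show ?thesis
  proof cases
    case 1
    then show ?thesis using assms by (intro sum_not_chord_if_increasing)
  next
    case 2
    then show ?thesis
      using assms sum_not_chord_if_increasing[of "\<lambda>x. - f x" a b]
      by (simp add: chord_set_uminus continuous_on_minus)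
  qed
qed

lemma chord_set_complement_multiple_add:
  fixes f :: "real \<Rightarrow> real"
  assumes "continuous_on {0..1} f" "0 \<le> a" "0 \<le> b" "a \<notin> chord_set f" "b \<notin> chord_set f"
    and "real k * a + b \<le> 1"
  shows "real k * a + b \<notin> chord_set f"
  using \<open>real k * a + b \<le> 1\<close>
proof (induction k)
  case 0
  then show ?case using assms by simp
next
  case (Suc k)
  have eq: "real (Suc k) * a + b = a + (real k * a + b)" by (simp add: algebra_simps)
  then have "real k * a + b \<notin> chord_set f" using Suc assms by simp
  then have "a + (real k * a + b) \<notin> chord_set f"
    by (intro chord_set_complement_add[of f a "real k * a + b"]) (use assms Suc.prems eq in auto)
  then show ?case unfolding eq .
qed

theorem theorem4:
  fixes n :: nat and f :: "real \<Rightarrow> real"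
  assumes "n \<ge> 2" and "f \<in> chord_class"
  shows "\<not> (1 / real n) isolated_in (chord_set f)"
proof
  assume "(1 / real n) isolated_in (chord_set f)"
  then obtain e where "e > 0"
    and iso: "chord_set f \<inter> {1 / real n - e<..<1 / real n + e} = {1 / real n}"
    unfolding isolated_in_real_iff by blast
  have f: "continuous_on {0..1} f" "f 0 = 0" "f 1 = 0"
    using \<open>f \<in> chord_class\<close> by (auto simp: chord_class_def)
  have n: "real n \<ge> 2" using \<open>n \<ge> 2\<close> by simp
  \<comment> \<open>Small enough that \<open>n \<delta>\<close> exceeds neither \<open>e\<close>, which keeps both lengths below in the
    neighbourhood free of other chords, nor \<open>1 / n\<close>, which keeps the second one positive.\<close>
  define \<delta> where "\<delta> = min e (1 / real n) / real n"
  have "\<delta> > 0" using \<open>e > 0\<close> n by (simp add: \<delta>_def)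
  have n\<delta>: "real n * \<delta> \<le> e" "real n * \<delta> \<le> 1 / real n"
    using n by (auto simp: \<delta>_def)
  define a where "a = 1 / real n + \<delta>"
  define b where "b = 1 / real n - real (n - 1) * \<delta>"
  have n1: "real (n - 1) = real n - 1" using \<open>n \<ge> 2\<close> by (simp add: of_nat_diff)
  have pos: "real (n - 1) * \<delta> > 0" using n n1 \<open>\<delta> > 0\<close> by simp
  have less: "real (n - 1) * \<delta> < real n * \<delta>" using n1 \<open>\<delta> > 0\<close> by simp
  have "\<delta> < real n * \<delta>" using n \<open>\<delta> > 0\<close> by simp
  then have "\<delta> < e" using n\<delta> by linarith
  then have "a \<in> {1 / real n - e<..<1 / real n + e}" "a \<noteq> 1 / real n"
    using \<open>\<delta> > 0\<close> \<open>e > 0\<close> by (auto simp: a_def)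
  then have "a \<notin> chord_set f" using iso by blast
  have "b \<in> {1 / real n - e<..<1 / real n + e}" "b \<noteq> 1 / real n"
    unfolding b_def greaterThanLessThan_iff using pos less \<open>e > 0\<close> n\<delta> by linarith+
  then have "b \<notin> chord_set f" using iso by blast
  have "0 \<le> a" using \<open>\<delta> > 0\<close> by (simp add: a_def)
  have "0 \<le> b" using less n\<delta> by (simp add: b_def)
  have sum: "real (n - 1) * a + b = 1"
    using n unfolding a_def b_def n1 by (simp add: field_simps)
  have "real (n - 1) * a + b \<notin> chord_set f"
    by (rule chord_set_complement_multiple_add) (use f sum \<open>0 \<le> a\<close> \<open>0 \<le> b\<close>
        \<open>a \<notin> chord_set f\<close> \<open>b \<notin> chord_set f\<close> in auto)
  moreover have "1 \<in> chord_set f" using f by (simp add: chord_set_iff)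
  ultimately show False using sum by simp
qed

end
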